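(* Let $F$ be Thompson's group, let $t$ be a generator of $\mathbb{Z}$, and let $\phi:F\to F$ be the endomorphism with $\phi(x_i)=x_{i+1}$ for all $i\ge 0$. Then the map $$\Phi: F\times\mathbb{Z}\longrightarrow F,\qquad \Phi(x,t^k)=(x_0x_1^{-1})^k\,\phi^2(x)\quad (x\in F,\ k\in\mathbb{Z}),$$ is a quasi-isometric embedding.
   Context: Thompson's group $F$ is the group with presentation $\langle x_k,\ k\ge 0 \mid x_i^{-1}x_jx_i=x_{j+1}\text{ if } i<j\rangle$. It is generated by $x_0$ and $x_1$ (and has the finite presentation $\langle x_0,x_1\mid [x_0x_1^{-1},x_0^{-1}x_1x_0],[x_0x_1^{-1},x_0^{-2}x_1x_0^2]\rangle$). The norm and word metric on $F$ are always taken with respect to the generating set $\{x_0,x_1\}$; the group $F\times\mathbb{Z}$ carries the word metric with respect to the generators $x_0,x_1$ of $F$ together with the generator $t$ of $\mathbb{Z}$, so that $|(x,t^k)|_{F\times\mathbb{Z}}=|x|_F+|k|$. The endomorphism $\phi$ is the homomorphism determined by $\phi(x_i)=x_{i+1}$ for all $i\ge0$ (it is well defined by the presentation), and $\phi^2=\phi\circ\phi$. A map $\Psi:X\to Y$ between metric spaces is a quasi-isometric embedding if there exist constants $K,C>0$ such that $\frac{d(x,x')}{K}-C\le d(\Psi(x),\Psi(x'))\le K\,d(x,x')+C$ for all $x,x'\in X$. *)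

theory Defs
  imports
    "HOL-Analysis.Abstract_Metric_Spaces"
    "HOL-Algebra.Elementary_Groups"
begin

section \<open>Groups given by presentations\<close>

text \<open>In a word over the alphabet \<open>'a\<close>, the letter \<open>(a, True)\<close> stands for \<open>a\<close> and
  \<open>(a, False)\<close> for its formal inverse. A relation \<open>(u, v)\<close> imposes \<open>u = v\<close>.\<close>

type_synonym 'a word = "('a \<times> bool) list"

inductive pres_eq :: "('a word \<times> 'a word) set \<Rightarrow> 'a word \<Rightarrow> 'a word \<Rightarrow> bool" for R where
  rel: "(u, v) \<in> R \<Longrightarrow> pres_eq R u v"
| cancel: "pres_eq R [(a, b), (a, \<not> b)] []"
| congr: "pres_eq R u v \<Longrightarrow> pres_eq R (p @ u @ q) (p @ v @ q)"
| refl: "pres_eq R u u"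
| sym: "pres_eq R u v \<Longrightarrow> pres_eq R v u"
| trans: "pres_eq R u v \<Longrightarrow> pres_eq R v w \<Longrightarrow> pres_eq R u w"

definition word_class :: "('a word \<times> 'a word) set \<Rightarrow> 'a word \<Rightarrow> 'a word set" where
  "word_class R u = {v. pres_eq R u v}"

definition presented_group :: "('a word \<times> 'a word) set \<Rightarrow> 'a word set monoid" where
  "presented_group R =
     \<lparr>carrier = range (word_class R),
      monoid.mult = (\<lambda>A B. \<Union>u\<in>A. \<Union>v\<in>B. word_class R (u @ v)),
      one = word_class R []\<rparr>"

lemma word_class_eq_iff: "word_class R u = word_class R v \<longleftrightarrow> pres_eq R u v"
  unfolding word_class_def using pres_eq.refl pres_eq.sym pres_eq.trans by blast

lemma pres_eq_append:
  assumes "pres_eq R u u'" "pres_eq R v v'"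
  shows "pres_eq R (u @ v) (u' @ v')"
  using pres_eq.congr[OF assms(1), of "[]" v] pres_eq.congr[OF assms(2), of u' "[]"]
  by (auto intro: pres_eq.trans)

lemma carrier_presented_group: "carrier (presented_group R) = range (word_class R)"
  by (simp add: presented_group_def)

lemma word_class_in_carrier [simp]: "word_class R u \<in> carrier (presented_group R)"
  by (simp add: presented_group_def)

lemma one_presented_group: "\<one>\<^bsub>presented_group R\<^esub> = word_class R []"
  by (simp add: presented_group_def)

lemma mult_presented_group:
  "word_class R u \<otimes>\<^bsub>presented_group R\<^esub> word_class R v = word_class R (u @ v)"
proof -
  have "word_class R (u' @ v') = word_class R (u @ v)"
    if "u' \<in> word_class R u" "v' \<in> word_class R v" for u' v'
    using that unfolding word_class_eq_iff
    by (auto simp: word_class_def intro: pres_eq_append pres_eq.sym)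
  moreover have "u \<in> word_class R u" "v \<in> word_class R v"
    by (auto simp: word_class_def pres_eq.refl)
  ultimately show ?thesis
    unfolding presented_group_def monoid.simps by blast
qed

definition inv_word :: "'a word \<Rightarrow> 'a word" where
  "inv_word w = rev (map (\<lambda>(a, b). (a, \<not> b)) w)"

lemma inv_word_left: "pres_eq R (inv_word w @ w) []"
proof (induction w)
  case Nil
  then show ?case by (simp add: inv_word_def pres_eq.refl)
next
  case (Cons x w)
  obtain a b where x: "x = (a, b)" by (cases x)
  have "pres_eq R [(a, \<not> b), (a, b)] []"
    using pres_eq.cancel[of R a "\<not> b"] by simp
  from pres_eq.congr[OF this, of "inv_word w" w]
  have "pres_eq R (inv_word (x # w) @ x # w) (inv_word w @ w)"
    by (simp add: inv_word_def x)
  then show ?case using Cons.IH pres_eq.trans by blast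
qed

lemma group_presented_group: "group (presented_group R)"
proof (rule groupI)
  fix A B assume "A \<in> carrier (presented_group R)" "B \<in> carrier (presented_group R)"
  then show "A \<otimes>\<^bsub>presented_group R\<^esub> B \<in> carrier (presented_group R)"
    by (auto simp: carrier_presented_group mult_presented_group)
next
  fix A assume "A \<in> carrier (presented_group R)"
  then obtain w where A: "A = word_class R w" by (auto simp: carrier_presented_group)
  have "word_class R (inv_word w) \<otimes>\<^bsub>presented_group R\<^esub> A = \<one>\<^bsub>presented_group R\<^esub>"
    by (simp add: A mult_presented_group one_presented_group word_class_eq_iff inv_word_left)
  then show "\<exists>B\<in>carrier (presented_group R). B \<otimes>\<^bsub>presented_group R\<^esub> A = \<one>\<^bsub>presented_group R\<^esub>"
    by (meson word_class_in_carrier)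
qed (auto simp: carrier_presented_group mult_presented_group one_presented_group)

lemma inv_presented_group:
  "inv\<^bsub>presented_group R\<^esub> (word_class R w) = word_class R (inv_word w)"
  by (rule group.inv_equality[OF group_presented_group])
     (simp_all add: mult_presented_group one_presented_group word_class_eq_iff inv_word_left)

section \<open>Thompson's group\<close>

definition thompson_relations :: "(nat word \<times> nat word) set" where
  "thompson_relations =
     {([(i, False), (j, True), (i, True)], [(Suc j, True)]) | i j. i < j}"

definition thompson_F :: "nat word set monoid" where
  "thompson_F = presented_group thompson_relations"

definition thompson_x :: "nat \<Rightarrow> nat word set" where
  "thompson_x k = word_class thompson_relations [(k, True)]"

lemma group_thompson_F: "group thompson_F"
  by (simp add: thompson_F_def group_presented_group)

lemma thompson_x_in_carrier [simp]: "thompson_x k \<in> carrier thompson_F"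
  by (simp add: thompson_F_def thompson_x_def)

lemma inv_thompson_x:
  "inv\<^bsub>thompson_F\<^esub> thompson_x k = word_class thompson_relations [(k, False)]"
  by (simp add: thompson_F_def thompson_x_def inv_presented_group inv_word_def)

lemma thompson_F_relation:
  assumes "i < j"
  shows "inv\<^bsub>thompson_F\<^esub> thompson_x i \<otimes>\<^bsub>thompson_F\<^esub> thompson_x j \<otimes>\<^bsub>thompson_F\<^esub> thompson_x i
    = thompson_x (Suc j)"
proof -
  have "pres_eq thompson_relations [(i, False), (j, True), (i, True)] [(Suc j, True)]"
    using assms by (intro pres_eq.rel) (auto simp: thompson_relations_def)
  then show ?thesis
    unfolding inv_thompson_x
    by (simp add: thompson_F_def thompson_x_def mult_presented_group word_class_eq_iff)
qed

lemma thompson_F_induct [consumes 1, case_names one pos neg]: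
  assumes "g \<in> carrier thompson_F"
    and "P \<one>\<^bsub>thompson_F\<^esub>"
    and "\<And>k g. g \<in> carrier thompson_F \<Longrightarrow> P g \<Longrightarrow> P (thompson_x k \<otimes>\<^bsub>thompson_F\<^esub> g)"
    and "\<And>k g. g \<in> carrier thompson_F \<Longrightarrow> P g \<Longrightarrow>
           P (inv\<^bsub>thompson_F\<^esub> thompson_x k \<otimes>\<^bsub>thompson_F\<^esub> g)"
  shows "P g"
proof -
  have "P (word_class thompson_relations w)" for w
  proof (induction w)
    case Nil
    then show ?case using assms(2) by (simp add: thompson_F_def one_presented_group)
  next
    case (Cons x w)
    obtain a b where x: "x = (a, b)" by (cases x)
    have c: "word_class thompson_relations w \<in> carrier thompson_F"
      by (simp add: thompson_F_def)
    have "word_class thompson_relations (x # w) =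
        word_class thompson_relations [(a, b)] \<otimes>\<^bsub>thompson_F\<^esub> word_class thompson_relations w"
      by (simp add: thompson_F_def mult_presented_group x)
    then show ?case
      using assms(3)[OF c Cons.IH, of a] assms(4)[OF c Cons.IH, of a]
      unfolding inv_thompson_x by (cases b) (auto simp: thompson_x_def)
  qed
  then show ?thesis
    using assms(1) by (auto simp: thompson_F_def carrier_presented_group)
qed

lemma generate_thompson_F:
  "generate thompson_F {thompson_x 0, thompson_x 1} = carrier thompson_F"
proof
  interpret group thompson_F by (rule group_thompson_F)
  let ?H = "generate thompson_F {thompson_x 0, thompson_x 1}"
  have S: "{thompson_x 0, thompson_x 1} \<subseteq> carrier thompson_F" by simp
  show "?H \<subseteq> carrier thompson_F" by (rule generate_incl[OF S])
  have x: "thompson_x (Suc k) \<in> ?H" for k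
  proof (induction k)
    case 0
    then show ?case by (auto intro: generate.incl)
  next
    case (Suc k)
    have "thompson_x 0 \<in> ?H" "inv\<^bsub>thompson_F\<^esub> thompson_x 0 \<in> ?H"
      by (auto intro: generate.incl generate.inv)
    then show ?case
      using Suc thompson_F_relation[of 0 "Suc k"] by (metis generate.eng zero_less_Suc)
  qed
  have x': "thompson_x k \<in> ?H" for k
    using x by (cases k) (auto intro: generate.incl)
  show "carrier thompson_F \<subseteq> ?H"
  proof
    fix g assume "g \<in> carrier thompson_F"
    then show "g \<in> ?H"
    proof (induction rule: thompson_F_induct)
      case one
      show ?case by (rule generate.one)
    next
      case (pos k g)
      show ?case by (rule generate.eng[OF x' pos(2)])
    next
      case (neg k g)
      show ?case by (rule generate.eng[OF generate_m_inv_closed[OF S x'] neg(2)])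
    qed
  qed
qed

lemma ex_thompson_shift:
  "\<exists>\<phi> \<in> hom thompson_F thompson_F. \<forall>i. \<phi> (thompson_x i) = thompson_x (Suc i)"
proof -
  let ?R = thompson_relations
  let ?s = "map (\<lambda>(i, b). (Suc i, b)) :: nat word \<Rightarrow> nat word"
  have s: "pres_eq ?R (?s u) (?s v)" if "pres_eq ?R u v" for u v
    using that
  proof induction
    case (rel u v)
    then show ?case by (intro pres_eq.rel) (auto simp: thompson_relations_def)
  qed (auto intro: pres_eq.intros)
  define \<phi> where "\<phi> A = (\<Union>w\<in>A. word_class ?R (?s w))" for A
  have \<phi>: "\<phi> (word_class ?R w) = word_class ?R (?s w)" for w
  proof -
    have "w \<in> word_class ?R w" by (simp add: word_class_def pres_eq.refl)
    moreover have "word_class ?R (?s w') = word_class ?R (?s w)" if "w' \<in> word_class ?R w" for w'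
      using that unfolding word_class_eq_iff by (auto simp: word_class_def intro: s pres_eq.sym)
    ultimately show ?thesis unfolding \<phi>_def by blast
  qed
  have "\<phi> \<in> hom thompson_F thompson_F"
    by (auto simp: hom_def thompson_F_def carrier_presented_group mult_presented_group \<phi>)
  moreover have "\<phi> (thompson_x i) = thompson_x (Suc i)" for i
    by (simp add: thompson_x_def \<phi>)
  ultimately show ?thesis by blast
qed

lemma thompson_shift_unique:
  assumes "\<phi> \<in> hom thompson_F thompson_F" "\<And>i. \<phi> (thompson_x i) = thompson_x (Suc i)"
    and "\<psi> \<in> hom thompson_F thompson_F" "\<And>i. \<psi> (thompson_x i) = thompson_x (Suc i)"
    and "g \<in> carrier thompson_F"
  shows "\<phi> g = \<psi> g"
proof -
  interpret group thompson_F by (rule group_thompson_F)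
  interpret \<phi>: group_hom thompson_F thompson_F \<phi>
    by unfold_locales (rule assms)
  interpret \<psi>: group_hom thompson_F thompson_F \<psi>
    by unfold_locales (rule assms)
  show ?thesis
    using assms(5) by (induction rule: thompson_F_induct) (simp_all add: assms(2,4))
qed

section \<open>Word metrics\<close>

definition word_norm :: "('a, 'b) monoid_scheme \<Rightarrow> 'a set \<Rightarrow> 'a \<Rightarrow> nat" where
  "word_norm G S g = (LEAST n. \<exists>ws. length ws = n \<and> set ws \<subseteq> S \<union> (\<lambda>s. inv\<^bsub>G\<^esub> s) ` S \<and>
     foldr (\<lambda>s h. s \<otimes>\<^bsub>G\<^esub> h) ws \<one>\<^bsub>G\<^esub> = g)"

text \<open>The value \<open>0\<close> off the carrier serves only to make the distance symmetric everywhere, as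
  \<^locale>\<open>Metric_space\<close> demands. The metric is meaningful when \<open>S\<close> generates \<open>G\<close>.\<close>

definition word_dist :: "('a, 'b) monoid_scheme \<Rightarrow> 'a set \<Rightarrow> 'a \<Rightarrow> 'a \<Rightarrow> real" where
  "word_dist G S g h =
     (if g \<in> carrier G \<and> h \<in> carrier G then real (word_norm G S (inv\<^bsub>G\<^esub> g \<otimes>\<^bsub>G\<^esub> h)) else 0)"

definition word_metric :: "('a, 'b) monoid_scheme \<Rightarrow> 'a set \<Rightarrow> 'a metric" where
  "word_metric G S = metric (carrier G, word_dist G S)"

context group
begin

abbreviation (input) word_prod :: "'a list \<Rightarrow> 'a" where
  "word_prod ws \<equiv> foldr (\<lambda>s h. s \<otimes> h) ws \<one>"

lemma word_prod_closed: "set ws \<subseteq> carrier G \<Longrightarrow> word_prod ws \<in> carrier G"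
  by (induction ws) auto

lemma word_prod_append:
  "set us \<subseteq> carrier G \<Longrightarrow> set vs \<subseteq> carrier G \<Longrightarrow>
    word_prod (us @ vs) = word_prod us \<otimes> word_prod vs"
  by (induction us) (auto simp: word_prod_closed m_assoc)

lemma word_prod_inv:
  "set us \<subseteq> carrier G \<Longrightarrow> word_prod (rev (map (\<lambda>s. inv s) us)) = inv (word_prod us)"
proof (induction us)
  case (Cons a us)
  have "set (rev (map (\<lambda>s. inv s) us)) \<subseteq> carrier G"
    using Cons.prems by auto
  then show ?case
    using Cons word_prod_append[of "rev (map (\<lambda>s. inv s) us)" "[inv a]"]
    by (simp add: word_prod_closed inv_mult_group)
qed simp

lemma word_norm_le:
  assumes "set ws \<subseteq> S \<union> (\<lambda>s. inv s) ` S" "word_prod ws = g"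
  shows "word_norm G S g \<le> length ws"
  unfolding word_norm_def by (rule Least_le) (use assms in blast)

lemma word_norm_witness:
  assumes S: "S \<subseteq> carrier G" and g: "g \<in> generate G S"
  obtains ws where "length ws = word_norm G S g" "set ws \<subseteq> S \<union> (\<lambda>s. inv s) ` S"
    "word_prod ws = g"
proof -
  have T: "S \<union> (\<lambda>s. inv s) ` S \<subseteq> carrier G" using S by auto
  have "\<exists>ws. set ws \<subseteq> S \<union> (\<lambda>s. inv s) ` S \<and> word_prod ws = g"
    using g
  proof induction
    case one
    then show ?case by (intro exI[of _ "[]"]) simp
  next
    case (incl h)
    then show ?case using S by (intro exI[of _ "[h]"]) auto
  next
    case (inv h)
    then show ?case using S by (intro exI[of _ "[inv h]"]) auto
  next
    case (eng h1 h2)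
    then obtain us vs where
      "set us \<subseteq> S \<union> (\<lambda>s. inv s) ` S" "word_prod us = h1"
      "set vs \<subseteq> S \<union> (\<lambda>s. inv s) ` S" "word_prod vs = h2" by blast
    moreover from this have "word_prod (us @ vs) = word_prod us \<otimes> word_prod vs"
      using T by (intro word_prod_append) blast+
    ultimately show ?case by (intro exI[of _ "us @ vs"]) simp
  qed
  then have "\<exists>n ws. length ws = n \<and> set ws \<subseteq> S \<union> (\<lambda>s. inv s) ` S \<and> word_prod ws = g" by blast
  from LeastI_ex[OF this] that show thesis
    unfolding word_norm_def by blast
qed

lemma Metric_space_word_dist:
  assumes S: "S \<subseteq> carrier G" and gen: "generate G S = carrier G"
  shows "Metric_space (carrier G) (word_dist G S)"
proof
  have T: "S \<union> (\<lambda>s. inv s) ` S \<subseteq> carrier G" using S by auto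
  have inv_le: "word_norm G S (inv g) \<le> word_norm G S g" if g: "g \<in> carrier G" for g
  proof -
    obtain ws where ws: "length ws = word_norm G S g" "set ws \<subseteq> S \<union> (\<lambda>s. inv s) ` S"
      "word_prod ws = g" using word_norm_witness[OF S] g gen by metis
    have "word_norm G S (inv g) \<le> length (rev (map (\<lambda>s. inv s) ws))"
    proof (rule word_norm_le)
      show "word_prod (rev (map (\<lambda>s. inv s) ws)) = inv g"
        using word_prod_inv ws T by blast
      show "set (rev (map (\<lambda>s. inv s) ws)) \<subseteq> S \<union> (\<lambda>s. inv s) ` S"
      proof
        fix y assume "y \<in> set (rev (map (\<lambda>s. inv s) ws))"
        then obtain s where "s \<in> S \<union> (\<lambda>s. inv s) ` S" "y = inv s"
          using ws(2) by (metis (no_types, lifting) imageE set_map set_rev subsetD)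
        then show "y \<in> S \<union> (\<lambda>s. inv s) ` S" using S by (auto simp: subset_iff)
      qed
    qed
    then show ?thesis using ws(1) by simp
  qed
  have inv_eq: "word_norm G S (inv g) = word_norm G S g" if "g \<in> carrier G" for g
    using inv_le[OF that] inv_le[of "inv g"] that by simp
  have mult_le: "word_norm G S (g \<otimes> h) \<le> word_norm G S g + word_norm G S h"
    if g: "g \<in> carrier G" and h: "h \<in> carrier G" for g h
  proof -
    obtain us where us: "length us = word_norm G S g" "set us \<subseteq> S \<union> (\<lambda>s. inv s) ` S"
      "word_prod us = g" using word_norm_witness[OF S] g gen by metis
    obtain vs where vs: "length vs = word_norm G S h" "set vs \<subseteq> S \<union> (\<lambda>s. inv s) ` S"
      "word_prod vs = h" using word_norm_witness[OF S] h gen by metis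
    have "word_prod (us @ vs) = g \<otimes> h"
      using word_prod_append[of us vs] us vs T by blast
    then show ?thesis
      using word_norm_le[of "us @ vs" S "g \<otimes> h"] us vs by simp
  qed
  have zero: "word_norm G S g = 0 \<longleftrightarrow> g = \<one>" if "g \<in> carrier G" for g
  proof
    assume "word_norm G S g = 0"
    then show "g = \<one>"
      using word_norm_witness[OF S, of g] that gen by (metis foldr.simps(1) id_apply length_0_conv)
  next
    assume "g = \<one>"
    then show "word_norm G S g = 0" using word_norm_le[of "[]" S g] by simp
  qed
  fix x y z
  show "0 \<le> word_dist G S x y" by (simp add: word_dist_def)
  show "word_dist G S x y = word_dist G S y x"
    using inv_eq[of "inv x \<otimes> y"] by (auto simp: word_dist_def inv_mult_group)
  assume x: "x \<in> carrier G" and y: "y \<in> carrier G"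
  have "inv x \<otimes> y = \<one> \<longleftrightarrow> x = y"
    using x y by (metis inv_closed inv_inv inv_equality l_inv)
  then show "word_dist G S x y = 0 \<longleftrightarrow> x = y"
    using x y zero[of "inv x \<otimes> y"] by (simp add: word_dist_def)
  assume z: "z \<in> carrier G"
  have "(inv x \<otimes> y) \<otimes> (inv y \<otimes> z) = inv x \<otimes> z"
    using x y z by (metis inv_closed inv_solve_left m_assoc m_closed)
  then show "word_dist G S x z \<le> word_dist G S x y + word_dist G S y z"
    using mult_le[of "inv x \<otimes> y" "inv y \<otimes> z"] x y z by (simp add: word_dist_def)
qed

lemma mspace_word_metric:
  "S \<subseteq> carrier G \<Longrightarrow> generate G S = carrier G \<Longrightarrow> mspace (word_metric G S) = carrier G"
  unfolding word_metric_def by (rule Metric_space.mspace_metric[OF Metric_space_word_dist])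

lemma mdist_word_metric:
  "S \<subseteq> carrier G \<Longrightarrow> generate G S = carrier G \<Longrightarrow> mdist (word_metric G S) = word_dist G S"
  unfolding word_metric_def by (rule Metric_space.mdist_metric[OF Metric_space_word_dist])

end

lemma generate_thompson_F_times_Z:
  assumes t: "generate integer_group {t} = carrier integer_group"
  defines "S \<equiv> {(thompson_x 0, \<one>\<^bsub>integer_group\<^esub>), (thompson_x 1, \<one>\<^bsub>integer_group\<^esub>),
    (\<one>\<^bsub>thompson_F\<^esub>, t)}"
  shows "S \<subseteq> carrier (thompson_F \<times>\<times> integer_group)"
    and "generate (thompson_F \<times>\<times> integer_group) S = carrier (thompson_F \<times>\<times> integer_group)"
proof -
  interpret F: group thompson_F by (rule group_thompson_F)
  interpret P: group "thompson_F \<times>\<times> integer_group"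
    by (simp add: DirProd_group group_thompson_F)
  show S: "S \<subseteq> carrier (thompson_F \<times>\<times> integer_group)" by (auto simp: S_def)
  let ?H = "generate (thompson_F \<times>\<times> integer_group) S"
  have inv_pair: "inv\<^bsub>thompson_F \<times>\<times> integer_group\<^esub> (g, k) =
      (inv\<^bsub>thompson_F\<^esub> g, inv\<^bsub>integer_group\<^esub> k)" if "g \<in> carrier thompson_F" for g k
    using that by (intro inv_DirProd) (auto simp: group_thompson_F)
  have F: "(g, 0) \<in> ?H" if "g \<in> carrier thompson_F" for g
  proof -
    from that have "g \<in> generate thompson_F {thompson_x 0, thompson_x 1}"
      by (simp only: generate_thompson_F)
    then show ?thesis
    proof induction
      case one
      then show ?case using generate.one[of "thompson_F \<times>\<times> integer_group" S] by simp
    next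
      case (incl h)
      then show ?case by (intro generate.incl) (auto simp: S_def)
    next
      case (inv h)
      then have "(h, 0) \<in> S" "h \<in> carrier thompson_F" by (auto simp: S_def)
      then show ?case using generate.inv[of "(h, 0)" S "thompson_F \<times>\<times> integer_group"]
        by (simp add: inv_pair)
    next
      case (eng h1 h2)
      then show ?case using generate.eng[OF eng.IH] by simp
    qed
  qed
  have Z: "(\<one>\<^bsub>thompson_F\<^esub>, k) \<in> ?H" for k
  proof -
    have "k \<in> generate integer_group {t}" by (simp add: t)
    then show ?thesis
    proof induction
      case one
      then show ?case using generate.one[of "thompson_F \<times>\<times> integer_group" S] by simp
    next
      case (incl h)
      then show ?case by (intro generate.incl) (auto simp: S_def)
    next
      case (inv h)
      then have "(\<one>\<^bsub>thompson_F\<^esub>, h) \<in> S" by (auto simp: S_def)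
      then show ?case
        using generate.inv[of "(\<one>\<^bsub>thompson_F\<^esub>, h)" S "thompson_F \<times>\<times> integer_group"]
        by (simp add: inv_pair)
    next
      case (eng h1 h2)
      then show ?case using generate.eng[OF eng.IH] by simp
    qed
  qed
  show "?H = carrier (thompson_F \<times>\<times> integer_group)"
  proof
    show "?H \<subseteq> carrier (thompson_F \<times>\<times> integer_group)" by (rule P.generate_incl[OF S])
    show "carrier (thompson_F \<times>\<times> integer_group) \<subseteq> ?H"
    proof
      fix p assume p: "p \<in> carrier (thompson_F \<times>\<times> integer_group)"
      obtain g k where gk: "p = (g, k)" by (cases p)
      then have "g \<in> carrier thompson_F" using p by simp
      then show "p \<in> ?H" using generate.eng[OF F Z, of g k] gk by simp
    qed
  qed
qed

section \<open>Quasi-isometric embeddings\<close>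

definition quasi_isometric_embedding :: "'a metric \<Rightarrow> 'b metric \<Rightarrow> ('a \<Rightarrow> 'b) \<Rightarrow> bool" where
  "quasi_isometric_embedding m1 m2 f \<longleftrightarrow>
     f \<in> mspace m1 \<rightarrow> mspace m2 \<and>
     (\<exists>K>0. \<exists>C>0. \<forall>x\<in>mspace m1. \<forall>y\<in>mspace m1.
        mdist m1 x y / K - C \<le> mdist m2 (f x) (f y) \<and>
        mdist m2 (f x) (f y) \<le> K * mdist m1 x y + C)"

end

theory Submission
  imports Defs "HOL-Algebra.Bij"
begin

text \<open>
  Write \<open>c = x\<^sub>0 x\<^sub>1\<inverse>\<close>. On \<open>\<phi>\<^sup>2(F)\<close>, conjugation by \<open>x\<^sub>0\<close> and conjugation by \<open>x\<^sub>1\<close> agree, so \<open>c\<close> centralizes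
  \<open>\<phi>\<^sup>2(F)\<close> and \<open>\<Phi>\<close> is a homomorphism. A homomorphism between finitely generated groups is Lipschitz,
  and by left invariance it only remains to bound \<open>|y| + |k|\<close> by a linear function of the norm of
  \<open>g = c\<^sup>k \<phi>\<^sup>2(y)\<close> (\<open>hom_quasi_isometric_embedding\<close>).

  The exponent sum of \<open>x\<^sub>0\<close> is a homomorphism to \<open>\<int>\<close> which vanishes on \<open>\<phi>(F)\<close> and takes the value \<open>k\<close> at \<open>g\<close>;
  hence \<open>|k| \<le> |g|\<close>, and \<open>|\<phi>\<^sup>2(y)| \<le> |g| + 2|k| \<le> 3|g|\<close>. Everything is thus reduced to the fact
  that \<open>\<phi>\<close> does not distort norms (\<open>shift_undistorted\<close>).

  For this, each element of norm \<open>n\<close> is written as a fraction \<open>p q\<inverse>\<close> of positive elements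
  \<open>x\<^sub>0\<^sup>e x\<^sub>1\<^sup>f x\<^sub>2\<^sup>g \<cdots>\<close> with at most \<open>n\<close> letters altogether and with indices at most \<open>n\<close>
  (\<open>fraction_form\<close>). Conversely, a positive element has norm linear in the number of letters and
  the largest index (\<open>norm_positive\<close>). If the fraction represents \<open>\<phi>\<^sup>a(y)\<close> with \<open>a > 0\<close>, then its
  numerator and denominator start with the same power \<open>x\<^sub>0\<^sup>e\<close>, and conjugation by that power followed
  by removing one shift from all indices yields a smaller fraction for \<open>\<phi>\<^sup>a\<^sup>+\<^sup>e\<^sup>-\<^sup>1(y)\<close>. Repeating this ends
  with a fraction for \<open>y\<close> that is no larger than the original one
  (\<open>norm_le_of_shifted_fraction\<close>).

  Removing the shift uses that \<open>\<phi>\<close> is injective (\<open>shift_injective\<close>). In a group given by a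
  presentation this needs a concrete action that detects the elements, here one in which a positive
  element acts as the corresponding binary forest (\<open>act_faithful_positive\<close>).
\<close>

section \<open>Word norms and homomorphisms\<close>

text \<open>A property that may worsen by one unit with each generator multiplied on the left holds with the
  norm as the number of units: induction along a shortest word.\<close>

lemma (in group) word_norm_induct [consumes 2, case_names one step]:
  assumes S: "S \<subseteq> carrier G" and g: "g \<in> generate G S"
    and one: "P 0 \<one>"
    and step: "\<And>n s h. s \<in> S \<union> (\<lambda>s. inv s) ` S \<Longrightarrow> h \<in> carrier G \<Longrightarrow> P n h \<Longrightarrow> P (Suc n) (s \<otimes> h)"
  shows "P (word_norm G S g) g"
proof -
  obtain ws where ws: "length ws = word_norm G S g" "set ws \<subseteq> S \<union> (\<lambda>s. inv s) ` S"
    "word_prod ws = g" using word_norm_witness[OF S g] .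
  have T: "S \<union> (\<lambda>s. inv s) ` S \<subseteq> carrier G" using S by auto
  have "P (length us) (word_prod us)" if "set us \<subseteq> S \<union> (\<lambda>s. inv s) ` S" for us
    using that
  proof (induction us)
    case Nil
    then show ?case using one by simp
  next
    case (Cons s us)
    then have "word_prod us \<in> carrier G" using T by (intro word_prod_closed) auto
    then show ?case using Cons step by simp
  qed
  from this[OF ws(2)] ws show ?thesis by simp
qed

text \<open>Reading a norm as the distance from the identity imports symmetry and the triangle
  inequality from the word metric.\<close>

lemma (in group) word_norm_eq_dist:
  "g \<in> carrier G \<Longrightarrow> real (word_norm G S g) = word_dist G S \<one> g"
  by (simp add: word_dist_def)

lemma (in group) word_norm_mult:
  assumes "S \<subseteq> carrier G" "generate G S = carrier G" "g \<in> carrier G" "h \<in> carrier G"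
  shows "word_norm G S (g \<otimes> h) \<le> word_norm G S g + word_norm G S h"
proof -
  interpret M: Metric_space "carrier G" "word_dist G S"
    by (rule Metric_space_word_dist) fact+
  have "inv g \<otimes> (g \<otimes> h) = h"
    using assms by (simp flip: m_assoc)
  then have "word_dist G S g (g \<otimes> h) = word_norm G S h"
    using assms by (simp add: word_dist_def)
  then show ?thesis
    using M.triangle[of \<one> g "g \<otimes> h"] assms by (simp flip: word_norm_eq_dist)
qed

lemma (in group) word_norm_inv:
  assumes "S \<subseteq> carrier G" "generate G S = carrier G" "g \<in> carrier G"
  shows "word_norm G S (inv g) = word_norm G S g"
proof -
  interpret M: Metric_space "carrier G" "word_dist G S"
    by (rule Metric_space_word_dist) fact+
  show ?thesis
    using M.commute[of g \<one>] assms by (simp add: word_dist_def)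
qed

lemma (in group) word_norm_one: "word_norm G S \<one> = 0"
  using word_norm_le[of "[]" S \<one>] by simp

lemma (in group) word_norm_generator: "s \<in> S \<Longrightarrow> s \<in> carrier G \<Longrightarrow> word_norm G S s \<le> 1"
  using word_norm_le[of "[s]" S s] by simp

lemma (in group) word_norm_nat_pow:
  assumes S: "S \<subseteq> carrier G" "generate G S = carrier G"
    and g: "g \<in> carrier G" "word_norm G S g \<le> m"
  shows "word_norm G S (g [^] (n::nat)) \<le> n * m"
proof (induction n)
  case 0
  then show ?case by (simp add: word_norm_one)
next
  case (Suc n)
  then show ?case using word_norm_mult[OF S, of "g [^] n" g] g by simp
qed

lemma (in group) word_norm_int_pow:
  assumes S: "S \<subseteq> carrier G" "generate G S = carrier G"
    and g: "g \<in> carrier G" "word_norm G S g \<le> m"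
  shows "word_norm G S (g [^] (k::int)) \<le> nat \<bar>k\<bar> * m"
proof (cases "k < 0")
  case True
  then have "g [^] k = inv (g [^] nat \<bar>k\<bar>)"
    unfolding int_pow_def2 by simp
  then show ?thesis
    using word_norm_nat_pow[OF assms] word_norm_inv[OF S nat_pow_closed[OF g(1)]]
    by (simp only:)
next
  case False
  then have "g [^] k = g [^] nat \<bar>k\<bar>"
    unfolding int_pow_def2 by simp
  then show ?thesis
    using word_norm_nat_pow[OF assms] by (simp only:)
qed

lemma hom_word_norm_le:
  assumes G: "group G" and H: "group H" and f: "f \<in> hom G H"
    and S: "finite S" "S \<subseteq> carrier G" "generate G S = carrier G"
    and T: "T \<subseteq> carrier H" "generate H T = carrier H"
  obtains K where "K > 0" "\<And>g. g \<in> carrier G \<Longrightarrow> word_norm H T (f g) \<le> K * word_norm G S g"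
proof -
  interpret group_hom G H f
    using G H f by (simp add: group_hom_def group_hom_axioms_def)
  define U where "U = S \<union> (\<lambda>s. inv\<^bsub>G\<^esub> s) ` S"
  have U: "finite U" "U \<subseteq> carrier G" using S by (auto simp: U_def)
  define K where "K = Suc (\<Sum>s\<in>U. word_norm H T (f s))"
  have K: "word_norm H T (f s) \<le> K" if "s \<in> U" for s
    using member_le_sum[OF that _ U(1), of "\<lambda>s. word_norm H T (f s)"] by (simp add: K_def)
  show thesis
  proof
    show "K > 0" by (simp add: K_def)
    fix g assume "g \<in> carrier G"
    then have g: "g \<in> generate G S" using S by simp
    show "word_norm H T (f g) \<le> K * word_norm G S g"
      using S(2) g
    proof (induction rule: G.word_norm_induct)
      case one
      then show ?case by (simp add: H.word_norm_one)
    next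
      case (step n s h)
      then have "s \<in> U" "s \<in> carrier G" using U by (auto simp: U_def)
      then show ?case
        using K[of s] H.word_norm_mult[OF T, of "f s" "f h"] step by simp
    qed
  qed
qed

text \<open>By left invariance, two-sided estimates on norms give those on distances. The upper estimate is
  automatic for a homomorphism defined on a finitely generated group, so only the lower one is
  assumed.\<close>

lemma hom_quasi_isometric_embedding:
  assumes G: "group G" and H: "group H" and f: "f \<in> hom G H"
    and S: "finite S" "S \<subseteq> carrier G" "generate G S = carrier G"
    and T: "T \<subseteq> carrier H" "generate H T = carrier H"
    and lower: "\<And>g. g \<in> carrier G \<Longrightarrow> word_norm G S g \<le> A * word_norm H T (f g) + B"
  shows "quasi_isometric_embedding (word_metric G S) (word_metric H T) f"
proof -
  interpret group_hom G H f
    using G H f by (simp add: group_hom_def group_hom_axioms_def)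
  obtain L where L: "\<And>g. g \<in> carrier G \<Longrightarrow> word_norm H T (f g) \<le> L * word_norm G S g"
    using hom_word_norm_le[OF G H f S T] by metis
  define K where "K = real (Suc (A + L))"
  define C where "C = real (Suc B)"
  have "word_dist G S g h / K - C \<le> word_dist H T (f g) (f h) \<and>
      word_dist H T (f g) (f h) \<le> K * word_dist G S g h + C"
    if g: "g \<in> carrier G" and h: "h \<in> carrier G" for g h
  proof -
    define u where "u = inv\<^bsub>G\<^esub> g \<otimes>\<^bsub>G\<^esub> h"
    have u: "u \<in> carrier G" using g h by (simp add: u_def)
    have dG: "word_dist G S g h = real (word_norm G S u)"
      using g h by (simp add: word_dist_def u_def)
    have dH: "word_dist H T (f g) (f h) = real (word_norm H T (f u))"
      using g h by (simp add: word_dist_def u_def)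
    have "word_norm G S u \<le> Suc (A + L) * (word_norm H T (f u) + Suc B)"
      using lower[OF u] by (simp add: algebra_simps)
    then have "real (word_norm G S u) \<le> K * (real (word_norm H T (f u)) + C)"
      unfolding K_def C_def by (simp only: of_nat_le_iff flip: of_nat_mult of_nat_add)
    then have "real (word_norm G S u) / K \<le> real (word_norm H T (f u)) + C"
      by (simp add: pos_divide_le_eq K_def mult.commute)
    moreover have "word_norm H T (f u) \<le> Suc (A + L) * word_norm G S u + Suc B"
      using L[OF u] by (simp add: algebra_simps)
    then have "real (word_norm H T (f u)) \<le> K * real (word_norm G S u) + C"
      unfolding K_def C_def by (simp only: of_nat_le_iff flip: of_nat_mult of_nat_add)
    ultimately show ?thesis by (simp add: dG dH)
  qed
  moreover have "K > 0" "C > 0" by (simp_all add: K_def C_def)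
  ultimately show ?thesis
    unfolding quasi_isometric_embedding_def
      G.mspace_word_metric[OF S(2,3)] H.mspace_word_metric[OF T]
      G.mdist_word_metric[OF S(2,3)] H.mdist_word_metric[OF T]
    by auto
qed

section \<open>Homomorphisms out of Thompson's group\<close>

lemma presented_group_universal:
  fixes G (structure)
  assumes "group G" and h: "\<And>a. h a \<in> carrier G"
    and rel: "\<And>u v. (u, v) \<in> R \<Longrightarrow>
      foldr (\<lambda>(a, b) y. (if b then h a else inv h a) \<otimes> y) u \<one> =
      foldr (\<lambda>(a, b) y. (if b then h a else inv h a) \<otimes> y) v \<one>"
  shows "\<exists>\<psi>\<in>hom (presented_group R) G. \<forall>a. \<psi> (word_class R [(a, True)]) = h a"
proof -
  interpret group G by fact
  define ev where "ev w = foldr (\<lambda>(a, b) y. (if b then h a else inv h a) \<otimes> y) w \<one>" for w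
  have ev_Cons: "ev ((a, b) # w) = (if b then h a else inv h a) \<otimes> ev w" for a b w
    by (simp add: ev_def)
  have ev_closed: "ev w \<in> carrier G" for w
    by (induction w) (auto simp: ev_def h)
  have ev_append: "ev (u @ v) = ev u \<otimes> ev v" for u v
  proof (induction u)
    case Nil
    then show ?case using ev_closed by (simp add: ev_def[of "[]"])
  next
    case (Cons p u)
    then show ?case using ev_closed h by (cases p) (simp add: ev_Cons m_assoc)
  qed
  have ev_eq: "ev u = ev v" if "pres_eq R u v" for u v
    using that
  proof induction
    case (rel u v)
    then show ?case using assms(3) by (simp add: ev_def)
  next
    case (cancel a b)
    then show ?case by (auto simp: ev_def h)
  next
    case (congr u v p q)
    then show ?case by (simp add: ev_append)
  qed auto
  define \<psi> where "\<psi> A = ev (SOME w. w \<in> A)" for A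
  have \<psi>: "\<psi> (word_class R w) = ev w" for w
  proof -
    have "w \<in> word_class R w" by (simp add: word_class_def pres_eq.refl)
    then have "(SOME w'. w' \<in> word_class R w) \<in> word_class R w" by (rule someI)
    then show ?thesis unfolding \<psi>_def by (simp add: word_class_def ev_eq)
  qed
  have "\<psi> \<in> hom (presented_group R) G"
    by (auto simp: hom_def carrier_presented_group mult_presented_group \<psi> ev_closed ev_append)
  moreover have "\<psi> (word_class R [(a, True)]) = h a" for a
    using h by (simp add: \<psi>) (simp add: ev_def)
  ultimately show ?thesis by blast
qed

text \<open>The defining relations are asked for in the form \<open>x\<^sub>j x\<^sub>i = x\<^sub>i x\<^sub>j\<^sub>+\<^sub>1\<close>, which contains no inverse and
  is therefore easy to verify in a concrete group.\<close>

lemma thompson_F_universal: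
  fixes G (structure)
  assumes "group G" and h: "\<And>i. h i \<in> carrier G"
    and rel: "\<And>i j. i < j \<Longrightarrow> h j \<otimes> h i = h i \<otimes> h (Suc j)"
  shows "\<exists>\<psi>\<in>hom thompson_F G. \<forall>i. \<psi> (thompson_x i) = h i"
  unfolding thompson_F_def thompson_x_def
proof (rule presented_group_universal[OF assms(1)])
  interpret group G by fact
  fix u v assume "(u, v) \<in> thompson_relations"
  then obtain i j where ij: "i < j" "u = [(i, False), (j, True), (i, True)]" "v = [(Suc j, True)]"
    by (auto simp: thompson_relations_def)
  have "inv h i \<otimes> (h j \<otimes> h i) = h (Suc j)"
    using rel[OF ij(1)] h by (simp flip: m_assoc)
  then show "foldr (\<lambda>(a, b) y. (if b then h a else inv h a) \<otimes> y) u \<one> =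
      foldr (\<lambda>(a, b) y. (if b then h a else inv h a) \<otimes> y) v \<one>"
    using h by (simp add: ij)
qed (rule h)

lemma thompson_F_hom_unique:
  assumes "group G" "f \<in> hom thompson_F G" "f' \<in> hom thompson_F G"
    and eq: "\<And>i. f (thompson_x i) = f' (thompson_x i)" and g: "g \<in> carrier thompson_F"
  shows "f g = f' g"
proof -
  interpret f: group_hom thompson_F G f
    using assms group_thompson_F by (simp add: group_hom_def group_hom_axioms_def)
  interpret f': group_hom thompson_F G f'
    using assms group_thompson_F by (simp add: group_hom_def group_hom_axioms_def)
  show ?thesis
    using g by (induction rule: thompson_F_induct) (simp_all add: eq)
qed

text \<open>The projection of the abelianization \<open>\<int>\<^sup>2\<close> of Thompson's group to the coordinate of \<open>x\<^sub>0\<close>. It vanishes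
  on the image of the shift.\<close>

definition x0_exponent :: "nat word set \<Rightarrow> int" where
  "x0_exponent = (SOME \<psi>. \<psi> \<in> hom thompson_F integer_group \<and>
     (\<forall>i. \<psi> (thompson_x i) = of_bool (i = 0)))"

lemma x0_exponent:
  "x0_exponent \<in> hom thompson_F integer_group"
  "x0_exponent (thompson_x i) = of_bool (i = 0)"
proof -
  have "\<exists>\<psi>. \<psi> \<in> hom thompson_F integer_group \<and> (\<forall>i. \<psi> (thompson_x i) = of_bool (i = 0))"
    using thompson_F_universal[of integer_group "\<lambda>i. of_bool (i = 0)"] by auto
  from someI_ex[OF this] show "x0_exponent \<in> hom thompson_F integer_group"
    "x0_exponent (thompson_x i) = of_bool (i = 0)"
    by (auto simp: x0_exponent_def)
qed

section \<open>Thompson's group acting on sequences\<close>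

text \<open>Positive elements of Thompson's group are binary forests: \<open>x\<^sub>i\<close> puts a caret on top of the \<open>i\<close>-th
  and the next tree of an infinite row. With a bijection \<open>\<nat> \<times> \<nat> \<rightarrow> \<nat>\<close> as the caret
  (so that natural numbers serve as trees), attaching a caret becomes an invertible operation on
  sequences of numbers, and the whole group acts. All that is needed of this action is
  that it separates positive elements.\<close>

primrec merge :: "nat \<Rightarrow> (nat \<Rightarrow> nat) \<Rightarrow> (nat \<Rightarrow> nat)" where
  "merge 0 s = case_nat (prod_encode (s 0, s 1)) (\<lambda>n. s (Suc (Suc n)))"
| "merge (Suc i) s = case_nat (s 0) (merge i (\<lambda>n. s (Suc n)))"

text \<open>The shift of Thompson's group corresponds to letting a permutation act behind the initial entry.\<close>

definition on_tail :: "((nat \<Rightarrow> nat) \<Rightarrow> nat \<Rightarrow> nat) \<Rightarrow> (nat \<Rightarrow> nat) \<Rightarrow> nat \<Rightarrow> nat" where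
  "on_tail f s = case_nat (s 0) (f (\<lambda>n. s (Suc n)))"

lemma on_tail_case_nat [simp]: "on_tail f (case_nat m s) = case_nat m (f s)"
  by (simp add: on_tail_def)

lemma case_nat_eq_iff [simp]: "case_nat a s = case_nat b t \<longleftrightarrow> a = b \<and> s = t"
proof
  assume eq: "case_nat a s = case_nat b t"
  have "s n = t n" for n using fun_cong[OF eq, of "Suc n"] by simp
  then show "a = b \<and> s = t" using fun_cong[OF eq, of 0] by auto
qed simp

lemma seq_cases: obtains m t where "s = case_nat m (t :: nat \<Rightarrow> 'a)"
proof
  show "s = case_nat (s 0) (\<lambda>n. s (Suc n))" by (auto split: nat.split)
qed

lemma merge_Suc: "merge (Suc i) = on_tail (merge i)"
  by (rule ext) (simp add: on_tail_def)

lemma bij_on_tail: "bij f \<Longrightarrow> bij (on_tail f)"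
proof (rule bijI)
  assume f: "bij f"
  show "inj (on_tail f)"
  proof (rule injI)
    fix s t assume eq: "on_tail f s = on_tail f t"
    obtain a s' b t' where "s = case_nat a s'" "t = case_nat b t'" by (metis seq_cases)
    then show "s = t" using eq bij_is_inj[OF f] by (simp add: inj_eq)
  qed
  show "surj (on_tail f)"
  proof (rule surjI)
    fix t :: "nat \<Rightarrow> nat"
    obtain b t' where "t = case_nat b t'" by (metis seq_cases)
    then show "on_tail f (on_tail (inv_into UNIV f) t) = t"
      using bij_is_surj[OF f] by (simp add: surj_f_inv_f)
  qed
qed

lemma bij_merge: "bij (merge i)"
proof (induction i)
  case 0
  show ?case
  proof (rule bijI)
    show "inj (merge 0)"
    proof (rule injI)
      fix s t assume eq: "merge 0 s = merge 0 t"
      obtain a b s' c d t' where "s = case_nat a (case_nat b s')" "t = case_nat c (case_nat d t')"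
        by (metis seq_cases)
      then show "s = t" using eq by (simp add: prod_encode_eq)
    qed
    show "surj (merge 0)"
    proof (rule surjI)
      fix t :: "nat \<Rightarrow> nat"
      obtain b t' where "t = case_nat b t'" by (metis seq_cases)
      then show "merge 0 (case prod_decode (t 0) of
          (m, n) \<Rightarrow> case_nat m (case_nat n (\<lambda>k. t (Suc k)))) = t"
        by (auto split: prod.split) (metis prod_decode_inverse)
    qed
  qed
next
  case (Suc i)
  then show ?case unfolding merge_Suc by (rule bij_on_tail)
qed

lemma merge_merge: "i < j \<Longrightarrow> merge j (merge i s) = merge i (merge (Suc j) s)"
proof (induction i arbitrary: j s)
  case 0
  then show ?case by (cases j) auto
next
  case (Suc i)
  then show ?case by (cases j) auto
qed

lemma carrier_BijGroup_UNIV: "carrier (BijGroup UNIV) = {f. bij f}"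
  by (auto simp: BijGroup_def Bij_def)

lemma mult_BijGroup_UNIV: "bij f \<Longrightarrow> bij g \<Longrightarrow> f \<otimes>\<^bsub>BijGroup UNIV\<^esub> g = f \<circ> g"
  by (simp add: BijGroup_def Bij_def compose_def comp_def restrict_def)

lemma on_tail_hom: "on_tail \<in> hom (BijGroup UNIV) (BijGroup UNIV)"
proof -
  have "on_tail (f \<circ> g) = on_tail f \<circ> on_tail g" for f g
    by (rule ext) (simp add: on_tail_def)
  then show ?thesis
    by (simp add: hom_def carrier_BijGroup_UNIV mult_BijGroup_UNIV bij_on_tail)
qed

definition act :: "nat word set \<Rightarrow> (nat \<Rightarrow> nat) \<Rightarrow> nat \<Rightarrow> nat" where
  "act = (SOME \<alpha>. \<alpha> \<in> hom thompson_F (BijGroup UNIV) \<and> (\<forall>i. \<alpha> (thompson_x i) = merge i))"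

lemma act: "act \<in> hom thompson_F (BijGroup UNIV)" "act (thompson_x i) = merge i"
proof -
  have "\<exists>\<alpha>. \<alpha> \<in> hom thompson_F (BijGroup UNIV) \<and> (\<forall>i. \<alpha> (thompson_x i) = merge i)"
    using thompson_F_universal[OF group_BijGroup[of UNIV], of merge]
    by (auto simp: carrier_BijGroup_UNIV mult_BijGroup_UNIV bij_merge merge_merge fun_eq_iff)
  from someI_ex[OF this] show "act \<in> hom thompson_F (BijGroup UNIV)" "act (thompson_x i) = merge i"
    by (auto simp: act_def)
qed

lemma bij_act: "g \<in> carrier thompson_F \<Longrightarrow> bij (act g)"
  using act(1) by (auto simp: hom_def carrier_BijGroup_UNIV)

lemma thompson_act_mult:
  "g \<in> carrier thompson_F \<Longrightarrow> h \<in> carrier thompson_F \<Longrightarrow>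
    act (g \<otimes>\<^bsub>thompson_F\<^esub> h) s = act g (act h s)"
  using act(1) by (simp add: hom_def mult_BijGroup_UNIV bij_act)

text \<open>The pairing function sends \<open>(0, 1)\<close> to \<open>1\<close>, so \<open>1\<close> is itself a pair; but its first component is
  \<open>0\<close>, and hence no pair whose first component is at least \<open>1\<close> equals \<open>1\<close>. This makes a
  nontrivial power of \<^term>\<open>merge 0\<close> visible on sequences that start with \<open>1\<close>.\<close>

lemma merge_0_pow_ge:
  assumes "s 0 \<ge> 1" "n > 0"
  shows "((merge 0 ^^ n) s) 0 \<ge> 2"
proof -
  have enc: "prod_encode (m, k) \<ge> 2" if "m \<ge> 1" for m k :: nat
  proof -
    obtain m' where "m = Suc m'" using \<open>m \<ge> 1\<close> by (cases m) auto
    then show ?thesis by (simp add: prod_encode_def)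
  qed
  have "((merge 0 ^^ Suc n) s) 0 \<ge> 2" for n
    by (induction n) (use enc assms in auto)
  then show ?thesis using assms(2) by (metis gr0_implies_Suc)
qed

section \<open>The shift endomorphism\<close>

lemma (in group) conj_hom:
  assumes d: "d \<in> carrier G"
  shows "(\<lambda>g. inv d \<otimes> g \<otimes> d) \<in> hom G G"
proof (rule homI)
  fix g h assume "g \<in> carrier G" "h \<in> carrier G"
  moreover from this have "d \<otimes> (inv d \<otimes> (h \<otimes> d)) = h \<otimes> d"
    using d by (simp flip: m_assoc)
  ultimately show "inv d \<otimes> (g \<otimes> h) \<otimes> d = inv d \<otimes> g \<otimes> d \<otimes> (inv d \<otimes> h \<otimes> d)"
    using d by (simp add: m_assoc)
qed (use d in simp)

text \<open>The parameter \<open>F\<close> is a name for Thompson's group, introduced as an implicit structure so that its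
  operations can be written without index.\<close>

locale thompson_shift =
  fixes F (structure) and \<phi>
  assumes F_def: "F = thompson_F"
    and shift_hom: "\<phi> \<in> hom F F"
    and shift_x: "\<phi> (thompson_x i) = thompson_x (Suc i)"
begin

abbreviation x :: "nat \<Rightarrow> nat word set" where "x \<equiv> thompson_x"

sublocale group F
  by (simp add: F_def group_thompson_F)

sublocale shift: group_hom F F \<phi>
  by unfold_locales (rule shift_hom)

lemma x_closed [simp]: "x i \<in> carrier F"
  by (simp add: F_def)

lemma funpow_shift_closed [simp]: "y \<in> carrier F \<Longrightarrow> (\<phi> ^^ n) y \<in> carrier F"
  by (induction n) auto

lemma funpow_shift_x: "(\<phi> ^^ n) (x k) = x (k + n)"
  by (induction n) (auto simp: shift_x)

text \<open>Both sides are homomorphisms in \<open>y\<close>, and on the generator \<open>x\<^sub>i\<close> the claim is the defining relation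
  \<open>x\<^sub>0\<inverse> x\<^sub>i\<^sub>+\<^sub>1 x\<^sub>0 = x\<^sub>i\<^sub>+\<^sub>2\<close>.\<close>

lemma shift_shift:
  assumes "y \<in> carrier F"
  shows "\<phi> (\<phi> y) = inv x 0 \<otimes> \<phi> y \<otimes> x 0"
proof -
  have "(\<phi> \<circ> \<phi>) y = (\<lambda>y. inv x 0 \<otimes> \<phi> y \<otimes> x 0) y"
  proof (rule thompson_F_hom_unique[of F "\<phi> \<circ> \<phi>" "\<lambda>y. inv x 0 \<otimes> \<phi> y \<otimes> x 0"])
    show "\<phi> \<circ> \<phi> \<in> hom thompson_F F"
      using Group.hom_compose[OF shift_hom shift_hom] by (simp add: F_def)
    show "(\<lambda>y. inv x 0 \<otimes> \<phi> y \<otimes> x 0) \<in> hom thompson_F F"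
      using Group.hom_compose[OF shift_hom conj_hom[of "x 0"]] by (simp add: comp_def flip: F_def)
    show "(\<phi> \<circ> \<phi>) (x i) = inv x 0 \<otimes> \<phi> (x i) \<otimes> x 0" for i
      using thompson_F_relation[of 0 "Suc i"] by (simp add: shift_x F_def)
  qed (use assms in \<open>simp_all add: F_def group_thompson_F\<close>)
  then show ?thesis by simp
qed

lemma shift_mult_x0: "y \<in> carrier F \<Longrightarrow> \<phi> y \<otimes> x 0 = x 0 \<otimes> \<phi> (\<phi> y)"
  by (simp add: shift_shift) (simp flip: m_assoc)

lemma shift_mult_x0_pow:
  "y \<in> carrier F \<Longrightarrow> \<phi> y \<otimes> x 0 [^] (n::nat) = x 0 [^] n \<otimes> \<phi> ((\<phi> ^^ n) y)"
proof (induction n)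
  case (Suc n)
  have "\<phi> y \<otimes> x 0 [^] Suc n = x 0 [^] n \<otimes> (\<phi> ((\<phi> ^^ n) y) \<otimes> x 0)"
    using Suc by (simp flip: m_assoc)
  also have "\<dots> = x 0 [^] n \<otimes> (x 0 \<otimes> \<phi> (\<phi> ((\<phi> ^^ n) y)))"
    using Suc.prems by (simp only: shift_mult_x0 funpow_shift_closed)
  also have "\<dots> = x 0 [^] Suc n \<otimes> \<phi> ((\<phi> ^^ Suc n) y)"
    using Suc.prems by (simp add: m_assoc)
  finally show ?case .
qed simp

section \<open>Positive elements and fractions\<close>

lemma x0_pow_Suc_mult:
  assumes "h \<in> carrier F"
  shows "x 0 [^] Suc n \<otimes> h = x 0 \<otimes> (x 0 [^] n \<otimes> h)"
  using assms by (subst nat_pow_Suc2) (simp_all add: m_assoc)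

text \<open>The recursion describes the normal form \<open>x\<^sub>0\<^sup>e x\<^sub>1\<^sup>f x\<^sub>2\<^sup>g \<cdots>\<close> of positive elements: all
  indices are below \<open>L\<close>, and \<open>N\<close> bounds the number of letters. Working with
  bounds instead of exact values makes the predicate monotone.\<close>

primrec positive :: "nat \<Rightarrow> nat \<Rightarrow> nat word set \<Rightarrow> bool" where
  "positive 0 N p \<longleftrightarrow> p = \<one>"
| "positive (Suc L) N p \<longleftrightarrow>
     (\<exists>e p'. e \<le> N \<and> positive L (N - e) p' \<and> p = x 0 [^] e \<otimes> \<phi> p')"

lemma positive_closed: "positive L N p \<Longrightarrow> p \<in> carrier F"
  by (induction L arbitrary: N p) auto

lemma positive_one: "positive L N \<one>"
  by (induction L) (auto intro!: exI[of _ 0] exI[of _ \<one>])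

lemma positive_mono:
  assumes "positive L N p" "L \<le> L'" "N \<le> N'"
  shows "positive L' N' p"
  using assms
proof (induction L arbitrary: L' N N' p)
  case 0
  then show ?case by (simp add: positive_one)
next
  case (Suc L)
  then obtain L'' e p' where "L' = Suc L''" "L \<le> L''" "e \<le> N" "positive L (N - e) p'"
    "p = x 0 [^] e \<otimes> \<phi> p'" by (auto simp: Suc_le_D dest: Suc_le_D)
  then show ?case
    using Suc.IH[of "N - e" p' L'' "N' - e"] Suc.prems by (auto intro!: exI[of _ e] exI[of _ p'])
qed

lemma positive_SucI:
  assumes "positive L N p" "e + N \<le> M"
  shows "positive (Suc L) M (x 0 [^] e \<otimes> \<phi> p)"
proof -
  have "positive L (M - e) p" using assms by (intro positive_mono[OF assms(1)]) auto
  then show ?thesis using assms(2) unfolding positive.simps by (intro exI[of _ e] exI[of _ p]) simp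
qed

lemma positive_shift: "positive L N p \<Longrightarrow> positive (Suc L) N (\<phi> p)"
  using positive_SucI[of L N p 0 N] positive_closed[of L N p] by simp

text \<open>A letter \<open>x\<^sub>k\<close> moves to the right past letters of smaller index, and each of them raises its
  index by one. Its final index is thus at most \<open>k + N\<close>.\<close>

lemma x_mult_positive:
  "positive L N p \<Longrightarrow> k + N < L \<Longrightarrow> positive L (Suc N) (x k \<otimes> p)"
proof (induction L arbitrary: k N p)
  case (Suc L)
  then obtain e p' where e: "e \<le> N" and p': "positive L (N - e) p'"
    and p: "p = x 0 [^] e \<otimes> \<phi> p'" by auto
  note c = positive_closed[OF p']
  show ?case
  proof (cases k)
    case 0
    then have "x k \<otimes> p = x 0 [^] Suc e \<otimes> \<phi> p'"
      using x0_pow_Suc_mult[of "\<phi> p'" e] c by (simp only: p shift.hom_closed)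
    then show ?thesis using positive_SucI[OF p', of "Suc e" "Suc N"] e by simp
  next
    case (Suc j)
    have "x k \<otimes> p = \<phi> (x j) \<otimes> x 0 [^] e \<otimes> \<phi> p'"
      using c by (simp add: p Suc shift_x m_assoc)
    also have "\<dots> = x 0 [^] e \<otimes> \<phi> (x (j + e) \<otimes> p')"
      using c by (simp add: shift_mult_x0_pow funpow_shift_x m_assoc)
    finally show ?thesis
      using Suc.IH[OF p', of "j + e"] Suc.prems Suc e
        positive_SucI[of L "Suc (N - e)" "x (j + e) \<otimes> p'" e "Suc N"] by simp
  qed
qed simp

text \<open>A letter \<open>x\<^sub>k\<close> moves to the left past letters of larger index without changing; it raises each
  of their indices by one, which costs one level.\<close>

lemma positive_mult_x:
  "positive L N p \<Longrightarrow> k \<le> L \<Longrightarrow> positive (Suc L) (Suc N) (p \<otimes> x k)"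
proof (induction L arbitrary: k N p)
  case 0
  then show ?case by (auto intro!: exI[of _ 1] exI[of _ \<one>])
next
  case (Suc L)
  then obtain e p' where e: "e \<le> N" and p': "positive L (N - e) p'"
    and p: "p = x 0 [^] e \<otimes> \<phi> p'" by auto
  note c = positive_closed[OF p']
  show ?case
  proof (cases k)
    case 0
    then have "p \<otimes> x k = x 0 [^] Suc e \<otimes> \<phi> (\<phi> p')"
      using c by (simp add: p m_assoc shift_mult_x0)
    then show ?thesis
      using positive_SucI[OF positive_shift[OF p'], of "Suc e" "Suc N"] e by simp
  next
    case (Suc j)
    then have "p \<otimes> x k = x 0 [^] e \<otimes> \<phi> (p' \<otimes> x j)"
      using c by (simp add: p m_assoc shift_x)
    then show ?thesis
      using positive_SucI[OF Suc.IH[OF p', of j], of e "Suc N"] Suc.prems Suc e by simp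
  qed
qed

text \<open>An inverse letter travels to the right, raised by letters of smaller index and raising
  those of larger index, until it either meets its own positive letter and cancels or
  leaves the positive element on the right.\<close>

lemma inv_x_mult_positive:
  "positive L N p \<Longrightarrow> \<exists>p'. positive (Suc L) N p' \<and>
     (inv x k \<otimes> p = p' \<or> (\<exists>k'\<le>k + N. inv x k \<otimes> p = p' \<otimes> inv x k'))"
proof (induction L arbitrary: k N p)
  case 0
  then show ?case
    by (intro exI[of _ \<one>] conjI disjI2 exI[of _ k] positive_one) simp_all
next
  case (Suc L)
  then obtain e p' where e: "e \<le> N" and p': "positive L (N - e) p'"
    and p: "p = x 0 [^] e \<otimes> \<phi> p'" by auto
  note c = positive_closed[OF p']
  consider (cancel) d where "k = 0" "e = Suc d" | (pass) "k = 0" "e = 0"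
    | (rec) j where "k = Suc j" by (metis not0_implies_Suc)
  then show ?case
  proof cases
    case cancel
    then have "inv x k \<otimes> p = x 0 [^] d \<otimes> \<phi> p'"
      using x0_pow_Suc_mult[of "\<phi> p'" d] c
      by (simp only: p shift.hom_closed) (simp flip: m_assoc)
    moreover have "positive (Suc (Suc L)) N (x 0 [^] d \<otimes> \<phi> p')"
      using e cancel by (intro positive_mono[OF positive_SucI[OF p', of d N]]) auto
    ultimately show ?thesis by blast
  next
    case pass
    have "inv x k \<otimes> p = \<phi> (\<phi> p') \<otimes> inv x 0"
      using c pass by (simp add: p shift_shift m_assoc)
    moreover have "positive (Suc (Suc L)) N (\<phi> (\<phi> p'))"
      using p' pass by (auto intro!: positive_shift simp del: positive.simps)
    ultimately show ?thesis by blast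
  next
    case (rec j)
    have "inv x k \<otimes> p = \<phi> (inv x j) \<otimes> x 0 [^] e \<otimes> \<phi> p'"
      using c by (simp add: p rec shift_x m_assoc)
    also have "\<dots> = x 0 [^] e \<otimes> \<phi> ((\<phi> ^^ e) (inv x j) \<otimes> p')"
      using c by (subst shift_mult_x0_pow) (simp_all add: m_assoc)
    also have "(\<phi> ^^ e) (inv x j) = inv x (j + e)"
      by (induction e) (auto simp: shift_x)
    finally have eq: "inv x k \<otimes> p = x 0 [^] e \<otimes> \<phi> (inv x (j + e) \<otimes> p')" .
    obtain r where r: "positive (Suc L) (N - e) r"
      and "inv x (j + e) \<otimes> p' = r \<or> (\<exists>k'\<le>j + e + (N - e). inv x (j + e) \<otimes> p' = r \<otimes> inv x k')"
      using Suc.IH[OF p', of "j + e"] by blast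
    then have "inv x k \<otimes> p = x 0 [^] e \<otimes> \<phi> r \<or>
      (\<exists>k'\<le>k + N. inv x k \<otimes> p = x 0 [^] e \<otimes> \<phi> r \<otimes> inv x k')"
    proof (elim disjE exE conjE)
      fix k' assume k': "k' \<le> j + e + (N - e)" "inv x (j + e) \<otimes> p' = r \<otimes> inv x k'"
      have "inv x k \<otimes> p = x 0 [^] e \<otimes> \<phi> r \<otimes> inv x (Suc k')"
        unfolding eq k'(2) using positive_closed[OF r] by (simp add: shift_x m_assoc)
      then show ?thesis using e rec k'(1) by (intro disjI2 exI[of _ "Suc k'"]) simp
    qed (simp add: eq)
    moreover have "positive (Suc (Suc L)) N (x 0 [^] e \<otimes> \<phi> r)"
      using positive_SucI[OF r, of e N] e by simp
    ultimately show ?thesis by blast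
  qed
qed

abbreviation norm_F :: "nat word set \<Rightarrow> nat" where
  "norm_F \<equiv> word_norm F {x 0, x 1}"

lemma generators: "{x 0, x 1} \<subseteq> carrier F" "generate F {x 0, x 1} = carrier F"
  using generate_thompson_F by (simp_all add: F_def)

text \<open>Every element is a fraction \<open>p q\<inverse>\<close> of positive elements, and multiplication by a generator enlarges the
  fraction only slightly: it adds at most one letter in total and at most one level. The indices in
  play never exceed the number of letters by more than one, so the new letter always fits.\<close>

lemma fraction_form:
  assumes "g \<in> carrier F"
  shows "\<exists>p q a b. positive (Suc (norm_F g)) a p \<and> positive (Suc (norm_F g)) b q \<and>
    a + b \<le> norm_F g \<and> g = p \<otimes> inv q"
proof -
  have g: "g \<in> generate F {x 0, x 1}" using assms generators by simp
  show ?thesis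
    using generators(1) g
  proof (induction rule: word_norm_induct)
    case one
    show ?case using positive_one[of 1 0] by (intro exI[of _ \<one>] exI[of _ 0]) auto
  next
    case (step n s g)
    then obtain p q a b where p: "positive (Suc n) a p" and q: "positive (Suc n) b q"
      and ab: "a + b \<le> n" and g: "g = p \<otimes> inv q" by blast
    note c = positive_closed[OF p] positive_closed[OF q]
    from step(1) obtain k where k: "k \<le> 1" "s = x k \<or> s = inv x k" by force
    from k(2) show ?case
    proof
      assume s: "s = x k"
      have "positive (Suc (Suc n)) (Suc a) (x k \<otimes> p)"
        using ab k by (intro x_mult_positive positive_mono[OF p]) auto
      moreover have "positive (Suc (Suc n)) b q" by (intro positive_mono[OF q]) auto
      moreover have "s \<otimes> g = x k \<otimes> p \<otimes> inv q" using c by (simp add: g s m_assoc)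
      ultimately show ?thesis using ab by (metis add_Suc Suc_le_mono)
    next
      assume s: "s = inv x k"
      obtain r where r: "positive (Suc (Suc n)) a r"
        and "inv x k \<otimes> p = r \<or> (\<exists>k'\<le>k + a. inv x k \<otimes> p = r \<otimes> inv x k')"
        using inv_x_mult_positive[OF p] by blast
      then consider (eq) "inv x k \<otimes> p = r"
        | (pass) k' where "k' \<le> k + a" "inv x k \<otimes> p = r \<otimes> inv x k'" by blast
      then show ?thesis
      proof cases
        case eq
        moreover have "positive (Suc (Suc n)) b q" by (intro positive_mono[OF q]) auto
        moreover have "s \<otimes> g = inv x k \<otimes> p \<otimes> inv q" using c by (simp add: g s m_assoc)
        ultimately show ?thesis using ab r by (metis le_SucI)
      next
        case pass
        have "positive (Suc (Suc n)) (Suc b) (q \<otimes> x k')"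
          using pass(1) k(1) ab by (intro positive_mult_x[OF q]) auto
        moreover have "s \<otimes> g = inv x k \<otimes> p \<otimes> inv q" using c by (simp add: g s m_assoc)
        then have "s \<otimes> g = r \<otimes> inv (q \<otimes> x k')"
          using c positive_closed[OF r] by (simp add: pass inv_mult_group m_assoc)
        ultimately show ?thesis using ab r by (metis add_Suc_right Suc_le_mono)
      qed
    qed
  qed
qed

section \<open>Injectivity of the shift\<close>

lemma act_mult: "g \<in> carrier F \<Longrightarrow> h \<in> carrier F \<Longrightarrow> act (g \<otimes> h) s = act g (act h s)"
  using thompson_act_mult by (simp add: F_def)

lemma act_one: "act \<one> s = s"
proof -
  have "act \<one> (act \<one> s) = act \<one> s"
    using act_mult[of \<one> \<one> s] by simp
  then show ?thesis using bij_is_inj[OF bij_act[of \<one>]] by (simp add: inj_eq flip: F_def)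
qed

lemma act_shift:
  assumes "y \<in> carrier F"
  shows "act (\<phi> y) = on_tail (act y)"
proof -
  have "(act \<circ> \<phi>) y = (on_tail \<circ> act) y"
  proof (rule thompson_F_hom_unique[OF group_BijGroup, of "act \<circ> \<phi>" UNIV "on_tail \<circ> act"])
    show "act \<circ> \<phi> \<in> hom thompson_F (BijGroup UNIV)"
      using Group.hom_compose[OF shift_hom[unfolded F_def] act(1)] .
    show "on_tail \<circ> act \<in> hom thompson_F (BijGroup UNIV)"
      using Group.hom_compose[OF act(1) on_tail_hom] .
    show "(act \<circ> \<phi>) (x i) = (on_tail \<circ> act) (x i)" for i
      by (simp add: act shift_x merge_Suc del: merge.simps)
  qed (use assms in \<open>simp add: F_def\<close>)
  then show ?thesis by simp
qed

lemma act_x0_pow: "act (x 0 [^] (n::nat)) s = (merge 0 ^^ n) s"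
proof (induction n arbitrary: s)
  case 0
  then show ?case by (simp add: act_one)
next
  case (Suc n)
  then show ?case by (simp add: act_mult act(2) funpow_swap1 del: merge.simps)
qed

text \<open>On sequences that start with \<open>1\<close> the entry in position \<open>0\<close> still shows whether a further
  power of \<open>x\<^sub>0\<close> has been applied, since a shifted element leaves that entry alone.\<close>

lemma act_leading_power_le:
  assumes "p \<in> carrier F" "q \<in> carrier F"
    and eq: "\<And>s. act (x 0 [^] (e::nat) \<otimes> \<phi> p) s = act (x 0 [^] (f::nat) \<otimes> \<phi> q) s"
  shows "f \<le> e"
proof (rule ccontr)
  assume "\<not> f \<le> e"
  then obtain d where f: "f = e + d" "d > 0"
    by (metis less_imp_add_positive not_le)
  define s where "s = (\<lambda>n::nat. 1::nat)"
  have "(merge 0 ^^ e) (on_tail (act p) s) = (merge 0 ^^ e) ((merge 0 ^^ d) (on_tail (act q) s))"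
    using eq[of s] assms(1,2)
    by (simp add: act_mult act_shift act_x0_pow f(1) funpow_add del: merge.simps)
  moreover have "inj (merge 0 ^^ e)"
    using bij_betw_funpow[OF bij_merge] bij_is_inj by blast
  ultimately have "on_tail (act p) s = (merge 0 ^^ d) (on_tail (act q) s)"
    by (simp only: inj_eq)
  moreover have "on_tail (act p) s 0 = 1" "on_tail (act q) s 0 = 1"
    by (simp_all add: on_tail_def s_def)
  ultimately show False using merge_0_pow_ge[of "on_tail (act q) s" d] f(2) by auto
qed

text \<open>The exponents of the normal form are recovered from the action one index after another.\<close>

lemma act_faithful_positive:
  "positive L N p \<Longrightarrow> positive L M q \<Longrightarrow> (\<And>s. act p s = act q s) \<Longrightarrow> p = q"
proof (induction L arbitrary: N M p q)
  case (Suc L)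
  then obtain e p' f q' where p': "positive L (N - e) p'" and p: "p = x 0 [^] e \<otimes> \<phi> p'"
    and q': "positive L (M - f) q'" and q: "q = x 0 [^] f \<otimes> \<phi> q'" by auto
  note c = positive_closed[OF p'] positive_closed[OF q']
  have e: "e = f"
    using act_leading_power_le[OF c, of e f] act_leading_power_le[OF c(2,1), of f e] Suc.prems(3)
    by (auto simp: p q)
  have inj: "inj (merge 0 ^^ e)"
    using bij_betw_funpow[OF bij_merge] bij_is_inj by blast
  have "act p' s = act q' s" for s
  proof -
    have "(merge 0 ^^ e) (case_nat 0 (act p' s)) = (merge 0 ^^ e) (case_nat 0 (act q' s))"
      using Suc.prems(3)[of "case_nat 0 s"] c
      by (simp add: p q e act_mult act_shift act_x0_pow del: merge.simps)
    then show ?thesis using inj by (simp add: inj_eq)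
  qed
  then have "p' = q'" using Suc.IH[OF p' q'] by blast
  then show ?case by (simp add: p q e)
qed simp

text \<open>If \<open>\<phi> y = 1\<close>, then \<open>y\<close> acts trivially, because the action of \<open>\<phi> y\<close> contains that of \<open>y\<close> on the
  tail. Writing \<open>y = p q\<inverse>\<close> reduces the claim to positive elements.\<close>

lemma shift_injective:
  assumes y: "y \<in> carrier F" and "\<phi> y = \<one>"
  shows "y = \<one>"
proof -
  obtain p q a b where p: "positive (Suc (norm_F y)) a p" and q: "positive (Suc (norm_F y)) b q"
    and y': "y = p \<otimes> inv q" using fraction_form[OF y] by blast
  note c = positive_closed[OF p] positive_closed[OF q]
  have pq: "p = y \<otimes> q" using c by (simp add: y' m_assoc)
  have "act y s = s" for s
  proof -
    have "on_tail (act y) (case_nat 0 s) = case_nat 0 s"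
      using act_shift[OF y] assms(2) act_one by metis
    then show ?thesis by simp
  qed
  then have "act p s = act q s" for s
    using c y by (simp add: pq act_mult)
  then have "p = q" by (rule act_faithful_positive[OF p q])
  then show ?thesis using c by (simp add: y')
qed

section \<open>The shift is undistorted\<close>

lemma norm_x_le: "norm_F (x 0) \<le> 1" "norm_F (x 1) \<le> 1" "norm_F (inv x 0) \<le> 1"
  using word_norm_generator[of _ "{x 0, x 1}"] word_norm_inv[OF generators, of "x 0"] by auto

lemma norm_mult: "g \<in> carrier F \<Longrightarrow> h \<in> carrier F \<Longrightarrow> norm_F (g \<otimes> h) \<le> norm_F g + norm_F h"
  by (rule word_norm_mult[OF generators])

lemma norm_pow_le:
  "g \<in> carrier F \<Longrightarrow> norm_F g \<le> 1 \<Longrightarrow> norm_F (g [^] (n::nat)) \<le> n"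
  using word_norm_nat_pow[OF generators, of g 1 n] by simp

text \<open>Conjugation by \<open>x\<^sub>0\<close> shifts everything in the image of \<open>\<phi>\<close>; so \<open>\<phi> p\<close> is spelled by powers of \<open>x\<^sub>1\<close>
  with a conjugation between consecutive ones, which costs two letters per level.\<close>

lemma norm_shift_positive: "positive L N p \<Longrightarrow> norm_F (\<phi> p) \<le> N + 2 * L"
proof (induction L arbitrary: N p)
  case 0
  then show ?case by (simp add: word_norm_one)
next
  case (Suc L)
  then obtain e p' where e: "e \<le> N" and p': "positive L (N - e) p'"
    and p: "p = x 0 [^] e \<otimes> \<phi> p'" by auto
  note c = positive_closed[OF p']
  have "\<phi> p = x 1 [^] e \<otimes> (inv x 0 \<otimes> \<phi> p' \<otimes> x 0)"
    using c shift_shift[OF c] by (simp add: p shift.hom_nat_pow shift_x)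
  then have "norm_F (\<phi> p) \<le> e + (1 + norm_F (\<phi> p') + 1)"
    using c norm_x_le norm_pow_le[of "x 1" e] norm_mult[of "x 1 [^] e" "inv x 0 \<otimes> \<phi> p' \<otimes> x 0"]
      norm_mult[of "inv x 0 \<otimes> \<phi> p'" "x 0"] norm_mult[of "inv x 0" "\<phi> p'"] by simp
  then show ?case using Suc.IH[OF p'] e by simp
qed

lemma norm_positive:
  assumes "positive L N p"
  shows "norm_F p \<le> N + 2 * L"
proof (cases L)
  case 0
  then show ?thesis using assms by (simp add: word_norm_one)
next
  case (Suc L')
  then obtain e p' where e: "e \<le> N" and p': "positive L' (N - e) p'"
    and p: "p = x 0 [^] e \<otimes> \<phi> p'" using assms by auto
  have "norm_F p \<le> e + norm_F (\<phi> p')"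
    using positive_closed[OF p'] norm_x_le norm_pow_le[of "x 0" e] norm_mult[of "x 0 [^] e" "\<phi> p'"]
    by (simp add: p)
  then show ?thesis using norm_shift_positive[OF p'] e Suc by simp
qed

lemma x0_exponent_mult:
  "g \<in> carrier F \<Longrightarrow> h \<in> carrier F \<Longrightarrow> x0_exponent (g \<otimes> h) = x0_exponent g + x0_exponent h"
  using x0_exponent(1) by (simp add: hom_def F_def)

lemma x0_exponent_inv: "g \<in> carrier F \<Longrightarrow> x0_exponent (inv g) = - x0_exponent g"
  using group_hom.hom_inv[of F integer_group x0_exponent g] x0_exponent(1) is_group
  by (simp add: group_hom_def group_hom_axioms_def F_def)

lemma x0_exponent_one: "x0_exponent \<one> = 0"
  using x0_exponent_mult[of \<one> \<one>] by simp

lemma x0_exponent_shift: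
  assumes "y \<in> carrier F"
  shows "x0_exponent (\<phi> y) = 0"
proof -
  have "x0_exponent \<circ> \<phi> \<in> hom thompson_F integer_group"
    using Group.hom_compose[OF shift_hom[unfolded F_def] x0_exponent(1)] .
  moreover have "(\<lambda>_. 0) \<in> hom thompson_F integer_group" by (simp add: hom_def)
  ultimately have "(x0_exponent \<circ> \<phi>) y = (\<lambda>_. 0) y"
    by (rule thompson_F_hom_unique[OF group_integer_group])
       (use assms in \<open>simp_all add: F_def x0_exponent(2) shift_x\<close>)
  then show ?thesis by simp
qed

lemma x0_exponent_x0_pow: "x0_exponent (x 0 [^] (n::nat)) = int n"
  by (induction n) (simp_all add: x0_exponent_mult x0_exponent_one x0_exponent(2))

text \<open>The heart of the proof: a fraction that represents \<open>\<phi>\<^sup>a(y)\<close> is converted into a bounded one that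
  represents \<open>y\<close>. If \<open>a > 0\<close>, the exponents of \<open>x\<^sub>0\<close> in numerator and denominator agree,
  since \<open>x\<^sub>0\<close> has total exponent \<open>0\<close> in \<open>\<phi>\<^sup>a(y)\<close>. Conjugating by \<open>x\<^sub>0\<^sup>e\<close> removes these powers and replaces
  \<open>\<phi>\<^sup>a(y)\<close> by \<open>\<phi>\<^sup>a\<^sup>+\<^sup>e(y)\<close>. Now all three elements are shifts, and cancelling one \<open>\<phi>\<close> leaves a fraction
  with one level less that represents \<open>\<phi>\<^sup>a\<^sup>+\<^sup>e\<^sup>-\<^sup>1(y)\<close>. The number of shifts may grow on the way, but
  the levels run out; an element some shift of which is trivial is itself trivial.\<close>

lemma norm_le_of_shifted_fraction:
  "positive L N p \<Longrightarrow> positive L M q \<Longrightarrow> y \<in> carrier F \<Longrightarrow> p \<otimes> inv q = (\<phi> ^^ a) y \<Longrightarrow>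
    norm_F y \<le> N + M + 4 * L"
proof (induction L arbitrary: N M p q a)
  case 0
  then have "(\<phi> ^^ a) y = \<one>" by simp
  then have "y = \<one>"
  proof (induction a)
    case (Suc a)
    then show ?case using shift_injective[of "(\<phi> ^^ a) y"] "0.prems" by simp
  qed simp
  then show ?case by (simp add: word_norm_one)
next
  case (Suc L)
  note c = positive_closed[OF Suc.prems(1)] positive_closed[OF Suc.prems(2)]
  show ?case
  proof (cases a)
    case 0
    then have "norm_F y \<le> norm_F p + norm_F q"
      using norm_mult[of p "inv q"] c Suc.prems(4) word_norm_inv[OF generators, of q] by simp
    then show ?thesis
      using norm_positive[OF Suc.prems(1)] norm_positive[OF Suc.prems(2)] by simp
  next
    case a: (Suc a')
    obtain e p' f q' where p': "positive L (N - e) p'" and p: "p = x 0 [^] e \<otimes> \<phi> p'"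
      and q': "positive L (M - f) q'" and q: "q = x 0 [^] f \<otimes> \<phi> q'"
      using Suc.prems(1,2) by auto
    note c' = positive_closed[OF p'] positive_closed[OF q']
    have eq: "p = \<phi> ((\<phi> ^^ a') y) \<otimes> q"
      using Suc.prems(3,4) c by (simp add: a flip: inv_solve_right)
    then have "x0_exponent p = x0_exponent q"
      using Suc.prems(3) c by (simp add: x0_exponent_mult x0_exponent_shift)
    then have e: "e = f"
      using c' by (simp add: p q x0_exponent_mult x0_exponent_shift x0_exponent_x0_pow)
    have "x 0 [^] f \<otimes> \<phi> p' = \<phi> ((\<phi> ^^ a') y) \<otimes> x 0 [^] f \<otimes> \<phi> q'"
      using eq c' Suc.prems(3) by (simp add: p q e m_assoc)
    also have "\<dots> = x 0 [^] f \<otimes> \<phi> ((\<phi> ^^ (f + a')) y \<otimes> q')"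
      using c' Suc.prems(3) by (simp add: shift_mult_x0_pow funpow_add m_assoc)
    finally have "\<phi> p' = \<phi> ((\<phi> ^^ (f + a')) y \<otimes> q')"
      using c' Suc.prems(3) by simp
    then have "\<phi> (p' \<otimes> inv ((\<phi> ^^ (f + a')) y \<otimes> q')) = \<one>"
      using c' Suc.prems(3) by simp
    then have "p' \<otimes> inv ((\<phi> ^^ (f + a')) y \<otimes> q') = \<one>"
      by (rule shift_injective[rotated]) (use c' Suc.prems(3) in auto)
    then have "p' = (\<phi> ^^ (f + a')) y \<otimes> q'"
      using c' Suc.prems(3) inv_equality[of p' "inv ((\<phi> ^^ (f + a')) y \<otimes> q')"] by simp
    then have "p' \<otimes> inv q' = (\<phi> ^^ (f + a')) y"
      using c' Suc.prems(3) by (simp add: m_assoc)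
    from Suc.IH[OF p' q' Suc.prems(3) this] show ?thesis by simp
  qed
qed

text \<open>If the image has norm \<open>n\<close>, it is a fraction with at most \<open>n\<close> letters and \<open>n + 1\<close> levels, and
  each level counts four times.\<close>

lemma shift_undistorted:
  assumes "y \<in> carrier F"
  shows "norm_F y \<le> 5 * norm_F ((\<phi> ^^ a) y) + 4"
proof -
  have "(\<phi> ^^ a) y \<in> carrier F" using assms by simp
  from fraction_form[OF this] obtain p q b c where
    "positive (Suc (norm_F ((\<phi> ^^ a) y))) b p" "positive (Suc (norm_F ((\<phi> ^^ a) y))) c q"
    "b + c \<le> norm_F ((\<phi> ^^ a) y)" "(\<phi> ^^ a) y = p \<otimes> inv q" by blast
  from norm_le_of_shifted_fraction[OF this(1,2) assms this(4)[symmetric]] this(3)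
  show ?thesis by simp
qed

lemma x0_exponent_le_norm:
  assumes "g \<in> carrier F"
  shows "\<bar>x0_exponent g\<bar> \<le> int (norm_F g)"
proof -
  have g: "g \<in> generate F {x 0, x 1}" using assms generators by simp
  show ?thesis
    using generators(1) g
  proof (induction rule: word_norm_induct)
    case one
    show ?case by (simp add: x0_exponent_one)
  next
    case (step n s h)
    have "s \<in> carrier F" "\<bar>x0_exponent s\<bar> \<le> 1"
      using step(1) by (auto simp: x0_exponent_inv x0_exponent(2))
    then show ?case using step by (simp add: x0_exponent_mult)
  qed
qed

section \<open>The embedding\<close>

text \<open>The image of the generator of \<open>\<int>\<close> under the embedding.\<close>

definition c :: "nat word set" where
  "c = x 0 \<otimes> inv x 1"

lemma c_closed [simp]: "c \<in> carrier F"
  by (simp add: c_def)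

text \<open>By \<open>shift_shift\<close> and its image under \<open>\<phi>\<close>, conjugation by \<open>x\<^sub>0\<close> and conjugation by \<open>x\<^sub>1\<close> act alike
  on \<open>\<phi>\<^sup>2(F)\<close>, namely as one further shift.\<close>

lemma c_commutes:
  assumes y: "y \<in> carrier F"
  shows "c \<otimes> \<phi> (\<phi> y) = \<phi> (\<phi> y) \<otimes> c"
proof -
  have 0: "\<phi> (\<phi> y) \<otimes> x 0 = x 0 \<otimes> \<phi> (\<phi> (\<phi> y))"
    using shift_mult_x0[of "\<phi> y"] y by simp
  have "\<phi> (\<phi> y) \<otimes> c = x 0 \<otimes> (\<phi> (\<phi> (\<phi> y)) \<otimes> inv x 1)"
    using y 0 by (simp add: c_def flip: m_assoc)
  also have "\<phi> (\<phi> (\<phi> y)) \<otimes> inv x 1 = inv x 1 \<otimes> \<phi> (\<phi> y)"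
  proof -
    have "\<phi> (\<phi> (\<phi> y)) = inv x 1 \<otimes> \<phi> (\<phi> y) \<otimes> x 1"
      using arg_cong[OF shift_shift[OF y], of \<phi>] y by (simp add: shift_x)
    then show ?thesis using y by (simp add: m_assoc)
  qed
  finally show ?thesis using y by (simp add: c_def m_assoc)
qed


lemma c_pow_commutes:
  assumes y: "y \<in> carrier F"
  shows "c [^] (k::int) \<otimes> \<phi> (\<phi> y) = \<phi> (\<phi> y) \<otimes> c [^] k"
proof -
  have "inv \<phi> (\<phi> y) \<otimes> c \<otimes> \<phi> (\<phi> y) = inv \<phi> (\<phi> y) \<otimes> (\<phi> (\<phi> y) \<otimes> c)"
    using y c_commutes[OF y] by (simp add: m_assoc)
  also have "\<dots> = c" using y by (simp flip: m_assoc)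
  finally have "inv \<phi> (\<phi> y) \<otimes> c [^] k \<otimes> \<phi> (\<phi> y) = c [^] k"
    using Group.hom_int_pow[OF conj_hom c_closed is_group is_group, of "\<phi> (\<phi> y)" k] y by simp
  then have "\<phi> (\<phi> y) \<otimes> (inv \<phi> (\<phi> y) \<otimes> c [^] k \<otimes> \<phi> (\<phi> y)) = \<phi> (\<phi> y) \<otimes> c [^] k"
    by simp
  then show ?thesis using y by (simp flip: m_assoc)
qed

lemma c_pow_shift_mult:
  assumes y: "y \<in> carrier F" and z: "z \<in> carrier F"
  shows "c [^] (k + l :: int) \<otimes> (\<phi> ^^ 2) (y \<otimes> z) =
    (c [^] k \<otimes> (\<phi> ^^ 2) y) \<otimes> (c [^] l \<otimes> (\<phi> ^^ 2) z)"
proof -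
  have "c [^] (k + l) \<otimes> (\<phi> ^^ 2) (y \<otimes> z) = c [^] k \<otimes> (c [^] l \<otimes> \<phi> (\<phi> y)) \<otimes> \<phi> (\<phi> z)"
    using y z by (simp add: numeral_2_eq_2 int_pow_mult m_assoc)
  also have "\<dots> = c [^] k \<otimes> (\<phi> (\<phi> y) \<otimes> c [^] l) \<otimes> \<phi> (\<phi> z)"
    by (simp only: c_pow_commutes[OF y])
  finally show ?thesis
    using y z by (simp add: numeral_2_eq_2 m_assoc)
qed

lemma x0_exponent_c_pow: "x0_exponent (c [^] (k::int)) = k"
proof -
  have "x0_exponent c = 1"
    by (simp add: c_def x0_exponent_mult x0_exponent_inv x0_exponent(2))
  then show ?thesis
    using Group.hom_int_pow[OF x0_exponent(1)[folded F_def] c_closed is_group group_integer_group]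
    by simp
qed

text \<open>The exponent of \<open>x\<^sub>0\<close> in \<open>c\<^sup>k \<phi>\<^sup>2(y)\<close> is \<open>k\<close>, so \<open>|k|\<close> is at most the norm of this
  element. Removing \<open>c\<^sup>k\<close> then at most triples the norm, and \<open>\<phi>\<^sup>2\<close> is undistorted;
  this gives the factor \<open>16 = 5 \<cdot> 3 + 1\<close>.\<close>

lemma norm_le_norm_image:
  assumes y: "y \<in> carrier F"
  shows "norm_F y + nat \<bar>k\<bar> \<le> 16 * norm_F (c [^] k \<otimes> (\<phi> ^^ 2) y) + 4"
proof -
  define g where "g = c [^] k \<otimes> (\<phi> ^^ 2) y"
  have g: "g \<in> carrier F" using y by (simp add: g_def)
  have "x0_exponent g = k"
    using y by (simp add: g_def x0_exponent_mult x0_exponent_c_pow x0_exponent_shift numeral_2_eq_2)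
  then have k: "nat \<bar>k\<bar> \<le> norm_F g"
    using x0_exponent_le_norm[OF g] by simp
  have "norm_F c \<le> 2"
    using norm_mult[of "x 0" "inv x 1"] norm_x_le word_norm_inv[OF generators, of "x 1"]
    by (simp add: c_def)
  then have "norm_F (c [^] k) \<le> nat \<bar>k\<bar> * 2"
    by (intro word_norm_int_pow[OF generators]) simp_all
  then have ck: "norm_F (inv (c [^] k)) \<le> 2 * norm_F g"
    using k word_norm_inv[OF generators, of "c [^] k"] by simp
  have "(\<phi> ^^ 2) y = inv (c [^] k) \<otimes> g"
    using y by (simp add: g_def flip: m_assoc)
  then have "norm_F ((\<phi> ^^ 2) y) \<le> 3 * norm_F g"
    using ck norm_mult[of "inv (c [^] k)" g] g by simp
  then show ?thesis
    using shift_undistorted[OF y, of 2] k by (simp flip: g_def)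
qed

end

theorem theorem3:
  fixes \<phi> :: "nat word set \<Rightarrow> nat word set"
    and t :: int
    and \<Phi> :: "nat word set \<times> int \<Rightarrow> nat word set"
  assumes "\<phi> \<in> hom thompson_F thompson_F"
    and "\<And>i. \<phi> (thompson_x i) = thompson_x (i + 1)"
    and "generate integer_group {t} = carrier integer_group"
    and "\<And>x k. x \<in> carrier thompson_F \<Longrightarrow>
      \<Phi> (x, t [^]\<^bsub>integer_group\<^esub> (k::int)) =
        (thompson_x 0 \<otimes>\<^bsub>thompson_F\<^esub> inv\<^bsub>thompson_F\<^esub> thompson_x 1) [^]\<^bsub>thompson_F\<^esub> k
          \<otimes>\<^bsub>thompson_F\<^esub> (\<phi> ^^ 2) x"
  shows "quasi_isometric_embedding
    (word_metric (thompson_F \<times>\<times> integer_group)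
      {(thompson_x 0, \<one>\<^bsub>integer_group\<^esub>), (thompson_x 1, \<one>\<^bsub>integer_group\<^esub>),
       (\<one>\<^bsub>thompson_F\<^esub>, t)})
    (word_metric thompson_F {thompson_x 0, thompson_x 1})
    \<Phi>"
proof -
  interpret thompson_shift thompson_F \<phi>
    by unfold_locales (use assms(1,2) in simp_all)
  let ?P = "thompson_F \<times>\<times> integer_group"
  let ?S = "{(thompson_x 0, \<one>\<^bsub>integer_group\<^esub>), (thompson_x 1, \<one>\<^bsub>integer_group\<^esub>),
    (\<one>\<^bsub>thompson_F\<^esub>, t)}"
  interpret P: group ?P
    by (simp add: DirProd_group group_thompson_F)
  note S = generate_thompson_F_times_Z[OF assms(3)]
  \<comment> \<open>Since \<open>t\<close> generates \<open>\<int>\<close>, the hypothesis on \<open>\<Phi>\<close> determines it on the whole product.\<close>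
  have pow_t: "\<exists>k. m = t [^]\<^bsub>integer_group\<^esub> (k::int)" for m
    using group.generate_pow[OF group_integer_group, of t] assms(3) by auto
  have P_cases: "\<exists>y k. y \<in> carrier thompson_F \<and> u = (y, t [^]\<^bsub>integer_group\<^esub> (k::int))"
    if "u \<in> carrier ?P" for u
  proof -
    obtain k where "snd u = t [^]\<^bsub>integer_group\<^esub> (k::int)" using pow_t by blast
    moreover have "fst u \<in> carrier thompson_F" using that by auto
    ultimately show ?thesis by (metis prod.collapse)
  qed
  have \<Phi>: "\<Phi> (y, t [^]\<^bsub>integer_group\<^esub> (k::int)) =
      c [^]\<^bsub>thompson_F\<^esub> k \<otimes>\<^bsub>thompson_F\<^esub> (\<phi> ^^ 2) y"
    if "y \<in> carrier thompson_F" for y k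
    using assms(4)[OF that] by (simp only: c_def)
  have hom: "\<Phi> \<in> hom ?P thompson_F"
  proof (rule homI)
    fix u assume "u \<in> carrier ?P"
    from P_cases[OF this] obtain y k where "y \<in> carrier thompson_F" "u = (y, t [^]\<^bsub>integer_group\<^esub> (k::int))"
      by blast
    then show "\<Phi> u \<in> carrier thompson_F" by (simp only: \<Phi>) simp
  next
    fix u v assume uv: "u \<in> carrier ?P" "v \<in> carrier ?P"
    from P_cases[OF uv(1)] obtain y k where y: "y \<in> carrier thompson_F"
      and u: "u = (y, t [^]\<^bsub>integer_group\<^esub> (k::int))" by blast
    from P_cases[OF uv(2)] obtain z l where z: "z \<in> carrier thompson_F"
      and v: "v = (z, t [^]\<^bsub>integer_group\<^esub> (l::int))" by blast
    have "u \<otimes>\<^bsub>?P\<^esub> v = (y \<otimes>\<^bsub>thompson_F\<^esub> z, t [^]\<^bsub>integer_group\<^esub> (k + l))"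
      by (simp add: u v distrib_right)
    then show "\<Phi> (u \<otimes>\<^bsub>?P\<^esub> v) = \<Phi> u \<otimes>\<^bsub>thompson_F\<^esub> \<Phi> v"
      using c_pow_shift_mult[OF y z, of k l] by (simp only: u v \<Phi> y z m_closed)
  qed
  have "(\<lambda>y. (y, 0)) \<in> hom thompson_F ?P" by (auto simp: hom_def)
  from hom_word_norm_le[OF group_thompson_F P.is_group this _ generators S]
  obtain K where K: "\<And>y. y \<in> carrier thompson_F \<Longrightarrow> word_norm ?P ?S (y, 0) \<le> K * norm_F y"
    by auto
  have Z_hom: "(\<lambda>m. (\<one>\<^bsub>thompson_F\<^esub>, m)) \<in> hom integer_group ?P" by (auto simp: hom_def)
  have "word_norm ?P ?S u \<le> Suc K * 16 * norm_F (\<Phi> u) + Suc K * 4"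
    if uP: "u \<in> carrier ?P" for u
  proof -
    from P_cases[OF uP] obtain y k where y: "y \<in> carrier thompson_F"
      and u: "u = (y, t [^]\<^bsub>integer_group\<^esub> (k::int))" by blast
    have t: "(\<one>\<^bsub>thompson_F\<^esub>, t) \<in> carrier ?P" by simp
    have y0: "(y, 0) \<in> carrier ?P" using y by simp
    have "(\<one>\<^bsub>thompson_F\<^esub>, t [^]\<^bsub>integer_group\<^esub> k) = (\<one>\<^bsub>thompson_F\<^esub>, t) [^]\<^bsub>?P\<^esub> k"
      using Group.hom_int_pow[OF Z_hom _ group_integer_group P.is_group, of t k] by simp
    moreover have "u = (y, 0) \<otimes>\<^bsub>?P\<^esub> (\<one>\<^bsub>thompson_F\<^esub>, t [^]\<^bsub>integer_group\<^esub> k)"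
      using y by (simp add: u)
    ultimately have "u = (y, 0) \<otimes>\<^bsub>?P\<^esub> (\<one>\<^bsub>thompson_F\<^esub>, t) [^]\<^bsub>?P\<^esub> k"
      by (simp only:)
    then have "word_norm ?P ?S u \<le>
        word_norm ?P ?S (y, 0) + word_norm ?P ?S ((\<one>\<^bsub>thompson_F\<^esub>, t) [^]\<^bsub>?P\<^esub> k)"
      using P.word_norm_mult[OF S y0 P.int_pow_closed[OF t]] by (simp only:)
    also have "\<dots> \<le> K * norm_F y + nat \<bar>k\<bar> * 1"
      by (intro add_mono K y P.word_norm_int_pow[OF S t] P.word_norm_generator[OF _ t]) simp
    finally have "word_norm ?P ?S u \<le> K * norm_F y + nat \<bar>k\<bar>" by simp
    also have "\<dots> \<le> Suc K * (norm_F y + nat \<bar>k\<bar>)" by (simp add: algebra_simps)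
    also have "\<dots> \<le> Suc K * (16 * norm_F (\<Phi> u) + 4)"
      unfolding u \<Phi>[OF y] by (intro mult_le_mono2 norm_le_norm_image y)
    finally show ?thesis by (simp add: algebra_simps)
  qed
  then show ?thesis
    by (intro hom_quasi_isometric_embedding[OF P.is_group group_thompson_F hom _ S generators]) auto
qed

end
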